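(* Let $\alpha,\beta\in\mathbb R_0^+$ with $\alpha+\beta\ne0$, let $f,g:\mathbb R\to\mathbb R$ and let $a,b\in\mathbb R$ with $a<b$ be such that $b\in\mathcal A:=\{a+k\alpha:k\in\mathbb N_0\}$ and $a\in\mathcal B:=\{b-k\beta:k\in\mathbb N_0\}$. If $|f|$ and $|g|$ are $\alpha,\beta$-symmetric integrable on $[a,b]$, then $$\int_a^b|f(t)g(t)|\,d_{\alpha,\beta}t\le\left(\int_a^b|f(t)|^p\,d_{\alpha,\beta}t\right)^{\frac1p}\left(\int_a^b|g(t)|^q\,d_{\alpha,\beta}t\right)^{\frac1q},$$ where $p>1$ and $q=p/(p-1)$.
   Context: $\mathbb R_0^+=[0,\infty)$, $\mathbb N_0=\{0,1,2,\dots\}$. For $\alpha>0$, the $\alpha$-forward integral of $f:\mathbb R\to\mathbb R$ is $\int_a^bf(t)\Delta_\alpha t=\int_a^{+\infty}f(t)\Delta_\alpha t-\int_b^{+\infty}f(t)\Delta_\alpha t$, where $\int_x^{+\infty}f(t)\Delta_\alpha t=\alpha\sum_{k=0}^{+\infty}f(x+k\alpha)$; $f$ is $\alpha$-forward integrable on $[a,b]$ if the series converges at $x=a$ and $x=b$. For $\beta>0$, the $\beta$-backward integral is $\int_a^bf(t)\nabla_\beta t=\int_{-\infty}^bf(t)\nabla_\beta t-\int_{-\infty}^af(t)\nabla_\beta t$, where $\int_{-\infty}^xf(t)\nabla_\beta t=\beta\sum_{k=0}^{+\infty}f(x-k\beta)$; $f$ is $\beta$-backward integrable on $[a,b]$ if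 the series converges at $x=a$ and $x=b$. For $\alpha,\beta\ge0$ with $\alpha+\beta>0$, $f$ is $\alpha,\beta$-symmetric integrable on $[a,b]$ if it is $\alpha$-forward and $\beta$-backward integrable on $[a,b]$ (if $\beta=0$ only the forward, if $\alpha=0$ only the backward integrability is required), and then $$\int_a^bf(t)\,d_{\alpha,\beta}t=\frac{\alpha}{\alpha+\beta}\int_a^bf(t)\Delta_\alpha t+\frac{\beta}{\alpha+\beta}\int_a^bf(t)\nabla_\beta t,$$ a term with coefficient $0$ being omitted. *)

theory Defs
  imports Complex_Main
begin

definition forward_integral_to_inf :: "real \<Rightarrow> (real \<Rightarrow> real) \<Rightarrow> real \<Rightarrow> real" where
  "forward_integral_to_inf \<alpha> f x = \<alpha> * (\<Sum>k. f (x + real k * \<alpha>))"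

definition forward_integrable :: "real \<Rightarrow> (real \<Rightarrow> real) \<Rightarrow> real \<Rightarrow> real \<Rightarrow> bool" where
  "forward_integrable \<alpha> f a b \<longleftrightarrow>
     summable (\<lambda>k. f (a + real k * \<alpha>)) \<and> summable (\<lambda>k. f (b + real k * \<alpha>))"

definition forward_integral :: "real \<Rightarrow> (real \<Rightarrow> real) \<Rightarrow> real \<Rightarrow> real \<Rightarrow> real" where
  "forward_integral \<alpha> f a b = forward_integral_to_inf \<alpha> f a - forward_integral_to_inf \<alpha> f b"

definition backward_integral_from_inf :: "real \<Rightarrow> (real \<Rightarrow> real) \<Rightarrow> real \<Rightarrow> real" where
  "backward_integral_from_inf \<beta> f x = \<beta> * (\<Sum>k. f (x - real k * \<beta>))"

definition backward_integrable :: "real \<Rightarrow> (real \<Rightarrow> real) \<Rightarrow> real \<Rightarrow> real \<Rightarrow> bool" where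
  "backward_integrable \<beta> f a b \<longleftrightarrow>
     summable (\<lambda>k. f (a - real k * \<beta>)) \<and> summable (\<lambda>k. f (b - real k * \<beta>))"

definition backward_integral :: "real \<Rightarrow> (real \<Rightarrow> real) \<Rightarrow> real \<Rightarrow> real \<Rightarrow> real" where
  "backward_integral \<beta> f a b = backward_integral_from_inf \<beta> f b - backward_integral_from_inf \<beta> f a"

text \<open>The one-sided notions are meant for positive steps only, so for \<open>\<alpha> = 0\<close> (resp. \<open>\<beta> = 0\<close>)
  no forward (resp. backward) integrability is demanded.\<close>

definition symmetric_integrable ::
    "real \<Rightarrow> real \<Rightarrow> (real \<Rightarrow> real) \<Rightarrow> real \<Rightarrow> real \<Rightarrow> bool" where
  "symmetric_integrable \<alpha> \<beta> f a b \<longleftrightarrow>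
     (\<alpha> \<noteq> 0 \<longrightarrow> forward_integrable \<alpha> f a b) \<and> (\<beta> \<noteq> 0 \<longrightarrow> backward_integrable \<beta> f a b)"

text \<open>A term with coefficient \<open>0\<close> vanishes whatever the value of its other factor, so no case
  distinction is needed to omit it. The value is meaningful only if
  \<^const>\<open>symmetric_integrable\<close> holds, since \<^const>\<open>suminf\<close> is unspecified on divergent series.\<close>

definition symmetric_integral ::
    "real \<Rightarrow> real \<Rightarrow> (real \<Rightarrow> real) \<Rightarrow> real \<Rightarrow> real \<Rightarrow> real" where
  "symmetric_integral \<alpha> \<beta> f a b =
     \<alpha> / (\<alpha> + \<beta>) * forward_integral \<alpha> f a b + \<beta> / (\<alpha> + \<beta>) * backward_integral \<beta> f a b"

end

theory Submission
  imports Defs "HOL-Analysis.Convex"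
begin

text \<open>Since \<open>a < b\<close>, both \<open>b \<in> \<A>\<close> and \<open>a \<in> \<B>\<close> force \<open>\<alpha>, \<beta> > 0\<close>, and the tails of the
  series defining the forward and backward integrals cancel: on integrable functions the symmetric
  integral is one finite sum with nonnegative weights. The inequality is then the
  weighted Hoelder inequality for finite sums. The remaining integrability claims hold because
  summable sequences tend to \<open>0\<close>, so eventually \<open>\<bar>f\<bar> powr p \<le> \<bar>f\<bar>\<close> and
  \<open>\<bar>f * g\<bar> \<le> \<bar>f\<bar>\<close>.\<close>

text \<open>Dividing \<open>x\<close> and \<open>y\<close> by their weighted norms reduces the claim
  to a bound by 1. Young's inequality, applied term by term and summed with the weights, then bounds
  the left side by 1 / p + 1 / q = 1.\<close>

lemma Holder_inequality_weighted_sum: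
  fixes p q :: real and w x y :: "'a \<Rightarrow> real"
  assumes "finite I" and pq: "p > 1" "q > 1" "1 / p + 1 / q = 1"
    and nonneg: "\<And>i. i \<in> I \<Longrightarrow> w i \<ge> 0" "\<And>i. i \<in> I \<Longrightarrow> x i \<ge> 0" "\<And>i. i \<in> I \<Longrightarrow> y i \<ge> 0"
  shows "(\<Sum>i\<in>I. w i * (x i * y i))
    \<le> (\<Sum>i\<in>I. w i * x i powr p) powr (1 / p) * (\<Sum>i\<in>I. w i * y i powr q) powr (1 / q)"
proof -
  define A where "A = (\<Sum>i\<in>I. w i * x i powr p)"
  define B where "B = (\<Sum>i\<in>I. w i * y i powr q)"
  have AB: "A \<ge> 0" "B \<ge> 0"
    unfolding A_def B_def by (auto intro!: sum_nonneg nonneg mult_nonneg_nonneg)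
  show ?thesis
  \<comment> \<open>Normalization divides by roots of \<open>A\<close> and \<open>B\<close>. If one
    of these sums vanishes, so does each of its nonnegative terms, so for every \<open>i\<close> the
    weight or the corresponding factor is 0.\<close>
  proof (cases "A = 0 \<or> B = 0")
    case True
    then have "\<forall>i\<in>I. w i * (x i * y i) = 0"
    proof
      assume "A = 0"
      then have "\<forall>i\<in>I. w i * x i powr p = 0"
        unfolding A_def using assms by (subst (asm) sum_nonneg_eq_0_iff) auto
      then show ?thesis by auto
    next
      assume "B = 0"
      then have "\<forall>i\<in>I. w i * y i powr q = 0"
        unfolding B_def using assms by (subst (asm) sum_nonneg_eq_0_iff) auto
      then show ?thesis by auto
    qed
    then have "(\<Sum>i\<in>I. w i * (x i * y i)) = 0" by (simp add: sum.neutral)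
    then show ?thesis by simp
  next
    case False
    then have pos: "A > 0" "B > 0" using AB by auto
    \<comment> \<open>The weighted norms of \<open>x\<close> and \<open>y\<close>: after division by
      \<open>u\<close> and \<open>v\<close>, the weighted power sums become 1.\<close>
    define u where "u = A powr (1 / p)"
    define v where "v = B powr (1 / q)"
    have uv: "u > 0" "v > 0" "u powr p = A" "v powr q = B"
      unfolding u_def v_def using pos pq by (auto simp: powr_powr)
    have "(\<Sum>i\<in>I. w i * (x i * y i)) / (u * v) = (\<Sum>i\<in>I. w i * (x i / u * (y i / v)))"
      by (simp add: sum_divide_distrib)
    also have "\<dots> \<le> (\<Sum>i\<in>I. w i * ((x i / u) powr p / p + (y i / v) powr q / q))"
      using pq nonneg uv by (intro sum_mono mult_left_mono Youngs_inequality) auto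
    also have "\<dots> = (\<Sum>i\<in>I. w i * x i powr p / (A * p) + w i * y i powr q / (B * q))"
      using nonneg uv by (intro sum.cong) (auto simp: powr_divide distrib_left)
    also have "\<dots> = A / (A * p) + B / (B * q)"
      by (simp add: sum.distrib A_def B_def flip: sum_divide_distrib)
    also have "\<dots> = 1" using pos pq by simp
    finally have "(\<Sum>i\<in>I. w i * (x i * y i)) \<le> u * v"
      using uv by (simp add: divide_le_eq)
    then show ?thesis by (simp add: u_def v_def A_def B_def)
  qed
qed

lemma summable_abs_powr:
  fixes f :: "nat \<Rightarrow> real"
  assumes "summable (\<lambda>k. \<bar>f k\<bar>)" and "p \<ge> 1"
  shows "summable (\<lambda>k. \<bar>f k\<bar> powr p)"
proof (rule summable_comparison_test_ev[OF _ assms(1)])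
  have "\<forall>\<^sub>F k in sequentially. \<bar>f k\<bar> < 1"
    using order_tendstoD(2)[OF summable_LIMSEQ_zero[OF assms(1)], of 1] by simp
  then show "\<forall>\<^sub>F k in sequentially. norm (\<bar>f k\<bar> powr p) \<le> \<bar>f k\<bar>"
  proof eventually_elim
    case (elim k)
    then show ?case using powr_mono'[of 1 p "\<bar>f k\<bar>"] assms(2) by simp
  qed
qed

lemma summable_abs_mult:
  fixes f g :: "nat \<Rightarrow> real"
  assumes "summable (\<lambda>k. \<bar>f k\<bar>)" and "summable (\<lambda>k. \<bar>g k\<bar>)"
  shows "summable (\<lambda>k. \<bar>f k * g k\<bar>)"
proof (rule summable_comparison_test_ev[OF _ assms(1)])
  have "\<forall>\<^sub>F k in sequentially. \<bar>g k\<bar> < 1"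
    using order_tendstoD(2)[OF summable_LIMSEQ_zero[OF assms(2)], of 1] by simp
  then show "\<forall>\<^sub>F k in sequentially. norm \<bar>f k * g k\<bar> \<le> \<bar>f k\<bar>"
    by eventually_elim (simp add: abs_mult mult_left_le)
qed

lemma symmetric_integrable_abs_powr:
  assumes "symmetric_integrable \<alpha> \<beta> (\<lambda>t. \<bar>f t\<bar>) a b" and "p \<ge> 1"
  shows "symmetric_integrable \<alpha> \<beta> (\<lambda>t. \<bar>f t\<bar> powr p) a b"
  using assms
  by (auto simp: symmetric_integrable_def forward_integrable_def backward_integrable_def
      intro!: summable_abs_powr)

lemma symmetric_integrable_abs_mult:
  assumes "symmetric_integrable \<alpha> \<beta> (\<lambda>t. \<bar>f t\<bar>) a b"
    and "symmetric_integrable \<alpha> \<beta> (\<lambda>t. \<bar>g t\<bar>) a b"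
  shows "symmetric_integrable \<alpha> \<beta> (\<lambda>t. \<bar>f t * g t\<bar>) a b"
  using assms
  by (auto simp: symmetric_integrable_def forward_integrable_def backward_integrable_def
      intro!: summable_abs_mult)

lemma forward_integral_eq_sum:
  assumes "forward_integrable \<alpha> f a b" and "b = a + real n * \<alpha>"
  shows "forward_integral \<alpha> f a b = \<alpha> * (\<Sum>k<n. f (a + real k * \<alpha>))"
proof -
  \<comment> \<open>As \<open>b\<close> is node number \<open>n\<close> counted from
    \<open>a\<close>, the series at \<open>b\<close> is the series at \<open>a\<close> without its
    first \<open>n\<close> terms. The node \<open>b\<close> itself is thus excluded from the finite
    sum.\<close>
  have shift: "a + real (k + n) * \<alpha> = b + real k * \<alpha>" for k
    using assms(2) by (simp add: algebra_simps)
  have "summable (\<lambda>k. f (a + real k * \<alpha>))"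
    using assms(1) by (simp add: forward_integrable_def)
  from suminf_split_initial_segment[OF this, of n] show ?thesis
    unfolding forward_integral_def forward_integral_to_inf_def shift by (simp only: distrib_left add_diff_cancel_left')
qed

lemma backward_integral_eq_sum:
  assumes "backward_integrable \<beta> f a b" and "a = b - real m * \<beta>"
  shows "backward_integral \<beta> f a b = \<beta> * (\<Sum>k<m. f (b - real k * \<beta>))"
proof -
  \<comment> \<open>Mirrored: the series at \<open>a\<close> is now a tail of the series at
    \<open>b\<close>, so \<open>b\<close> is kept and \<open>a\<close> excluded.\<close>
  have shift: "b - real (k + m) * \<beta> = a - real k * \<beta>" for k
    using assms(2) by (simp add: algebra_simps)
  have "summable (\<lambda>k. f (b - real k * \<beta>))"
    using assms(1) by (simp add: backward_integrable_def)
  from suminf_split_initial_segment[OF this, of m] show ?thesis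
    unfolding backward_integral_def backward_integral_from_inf_def shift by (simp only: distrib_left add_diff_cancel_left')
qed

text \<open>The forward and backward nodes may overlap, hence the disjoint sum as index set.\<close>

lemma symmetric_integral_eq_sum:
  assumes "symmetric_integrable \<alpha> \<beta> f a b" and "\<alpha> \<noteq> 0" and "\<beta> \<noteq> 0"
    and "b = a + real n * \<alpha>" and "a = b - real m * \<beta>"
  shows "symmetric_integral \<alpha> \<beta> f a b =
    (\<Sum>s\<in>{..<n} <+> {..<m}. case_sum (\<lambda>_. \<alpha>\<^sup>2 / (\<alpha> + \<beta>)) (\<lambda>_. \<beta>\<^sup>2 / (\<alpha> + \<beta>)) s
      * f (case_sum (\<lambda>k. a + real k * \<alpha>) (\<lambda>k. b - real k * \<beta>) s))"
proof -
  have "forward_integral \<alpha> f a b = \<alpha> * (\<Sum>k<n. f (a + real k * \<alpha>))"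
    using assms(1,2) by (intro forward_integral_eq_sum assms(4)) (simp add: symmetric_integrable_def)
  moreover have "backward_integral \<beta> f a b = \<beta> * (\<Sum>k<m. f (b - real k * \<beta>))"
    using assms(1,3) by (intro backward_integral_eq_sum assms(5)) (simp add: symmetric_integrable_def)
  ultimately show ?thesis
    \<comment> \<open>Each squared step in the weights combines the step size of a one-sided
      integral with its coefficient in the symmetric integral.\<close>
    by (simp add: symmetric_integral_def sum.Plus power2_eq_square sum_distrib_left sum_divide_distrib
        mult.assoc)
qed

text \<open>The integrability conjuncts ensure that the integrals in the inequality are values of
  convergent series.\<close>

theorem theorem5p3p17:
  fixes \<alpha> \<beta> a b p q :: real and f g :: "real \<Rightarrow> real"
  assumes "\<alpha> \<ge> 0" and "\<beta> \<ge> 0" and "\<alpha> + \<beta> \<noteq> 0"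
    and "a < b"
    and "b \<in> {a + real k * \<alpha> | k. True}"
    and "a \<in> {b - real k * \<beta> | k. True}"
    and "symmetric_integrable \<alpha> \<beta> (\<lambda>t. \<bar>f t\<bar>) a b"
    and "symmetric_integrable \<alpha> \<beta> (\<lambda>t. \<bar>g t\<bar>) a b"
    and "p > 1" and "q = p / (p - 1)"
  shows "symmetric_integrable \<alpha> \<beta> (\<lambda>t. \<bar>f t * g t\<bar>) a b \<and>
    symmetric_integrable \<alpha> \<beta> (\<lambda>t. \<bar>f t\<bar> powr p) a b \<and>
    symmetric_integrable \<alpha> \<beta> (\<lambda>t. \<bar>g t\<bar> powr q) a b \<and>
    symmetric_integral \<alpha> \<beta> (\<lambda>t. \<bar>f t * g t\<bar>) a b
      \<le> symmetric_integral \<alpha> \<beta> (\<lambda>t. \<bar>f t\<bar> powr p) a b powr (1 / p)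
        * symmetric_integral \<alpha> \<beta> (\<lambda>t. \<bar>g t\<bar> powr q) a b powr (1 / q)"
proof -
  obtain n m where nm: "b = a + real n * \<alpha>" "a = b - real m * \<beta>"
    using assms(5,6) by blast
  have nz: "\<alpha> \<noteq> 0" "\<beta> \<noteq> 0"
    using nm(1) nm(2) \<open>a < b\<close> by force+
  have q: "q > 1" "1 / p + 1 / q = 1"
    unfolding \<open>q = p / (p - 1)\<close> using \<open>p > 1\<close> by (simp_all add: field_simps)
  have int: "symmetric_integrable \<alpha> \<beta> (\<lambda>t. \<bar>f t * g t\<bar>) a b"
    "symmetric_integrable \<alpha> \<beta> (\<lambda>t. \<bar>f t\<bar> powr p) a b"
    "symmetric_integrable \<alpha> \<beta> (\<lambda>t. \<bar>g t\<bar> powr q) a b"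
    using assms(7,8) \<open>p > 1\<close> q
    by (auto intro: symmetric_integrable_abs_mult symmetric_integrable_abs_powr)
  have "symmetric_integral \<alpha> \<beta> (\<lambda>t. \<bar>f t * g t\<bar>) a b
      \<le> symmetric_integral \<alpha> \<beta> (\<lambda>t. \<bar>f t\<bar> powr p) a b powr (1 / p)
        * symmetric_integral \<alpha> \<beta> (\<lambda>t. \<bar>g t\<bar> powr q) a b powr (1 / q)"
    \<comment> \<open>All three integrals become sums over the same nodes with the same weights. The
      absolute value of the product is split only afterwards, since the first rewriting has to match
      it unsplit.\<close>
    unfolding int[THEN symmetric_integral_eq_sum[OF _ nz nm]] unfolding abs_mult
    using \<open>\<alpha> \<ge> 0\<close> \<open>\<beta> \<ge> 0\<close> \<open>p > 1\<close> q
    by (intro Holder_inequality_weighted_sum) (auto split: sum.split)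
  with int show ?thesis by blast
qed

end
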